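(* Let $M$ be a finitely generated preGarside monoid. Then $d_2\le d_1$, i.e. $d_2(u,v)\le d_1(u,v)$ for all $u,v\in M$.
   Context: $a\preceq b$ means $b=ac$ for some $c\in M$. A monoid $M$ is atomic if there is a norm $\nu:M\to\mathbb N$ with $\nu(a)>0$ for $a\neq1$ and $\nu(ab)\ge\nu(a)+\nu(b)$. $M$ is preGarside if it is atomic, left and right cancellative, any $a,b\in M$ having a common right multiple have a least one (for $\preceq$), and any $a,b$ having a common left multiple have a least one (for right divisibility). $S=\mathcal S(M)$ is the (finite) set of atoms. $M_{\mathrm{red}}\subseteq M$ is the fixed subset carrying the "preGarside structure" of Bessis–Digne–Michel ("Springer theory in braid groups and the Birman–Ko–Lee monoid"); the properties used are: it contains $1$ and $S$, it contains all left and right divisors of its elements, and for every $u\in M$ the set $\{v\in M_{\mathrm{red}}:v\preceq u\}$ has a unique maximal element $\alpha(u)$ for $\preceq$ (every member of the set left-divides $\alpha(u)$), where $\alpha:M\to M_{\mathrm{red}}$ is the identity on $M_{\mathrm{red}}$ and satisfies $\alpha(uv)=\alpha(u\alpha(v))$ for all $u,v\in M$. (For an Artin monoid, $M_{\mathrm{red}}$ is the set of elements having the same length as their image in the Coxeter group.) Greedy normal form: for $u\neq1$, $\iota_1(u)=(u_1,\dots,u_n)$ is the unique sequence in $M_{\mathrm{red}}\setminus\{1\}$ with $u=u_1\cdots u_n$ and $u_i=\alpha(u_i\cdots u_n)$ for all $i$; $\iota_1(1)$ is the empty sequence. Foata normal form: for $T\subseteq S$ having a common right multiple, $\Delta(T)$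 is its least common right multiple. For $u\ne1$, $\iota_2(u)=(u_1,\dots,u_n)$ is the unique sequence of non-trivial elements with $u=u_1\cdots u_n$ and $u_i=\Delta(\{s\in S: s\preceq u_i\cdots u_n\})$ for all $i$; $\iota_2(1)$ is the empty sequence. For $i\in\{1,2\}$ and $u\ne v$, $r_i(u,v)$ is the largest $k\ge0$ such that the sequences $\iota_i(u),\iota_i(v)$ both have at least $k$ terms and agree in their first $k$ terms; $r_i(u,u)=\infty$; $d_i(u,v)=2^{-r_i(u,v)}$ with $2^{-\infty}=0$. *)

theory Defs
  imports "HOL-Algebra.Divisibility" "HOL-Library.Extended_Nat" Complex_Main
begin

text \<open>
  The library relation \<open>a divides\<^bsub>M\<^esub> b\<close> (there is \<open>c\<close> in the carrier with \<open>b = a \<otimes> c\<close>) is, in a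
  noncommutative monoid, exactly the left divisibility written \<open>\<preceq>\<close> in the literature on Garside
  monoids.
\<close>

definition right_divides :: "('a, 'b) monoid_scheme \<Rightarrow> 'a \<Rightarrow> 'a \<Rightarrow> bool" where
  "right_divides M a b \<longleftrightarrow> (\<exists>c\<in>carrier M. b = c \<otimes>\<^bsub>M\<^esub> a)"

definition common_right_multiple :: "('a, 'b) monoid_scheme \<Rightarrow> 'a set \<Rightarrow> 'a \<Rightarrow> bool" where
  "common_right_multiple M T m \<longleftrightarrow> m \<in> carrier M \<and> (\<forall>t\<in>T. t divides\<^bsub>M\<^esub> m)"

definition least_common_right_multiple :: "('a, 'b) monoid_scheme \<Rightarrow> 'a set \<Rightarrow> 'a \<Rightarrow> bool" where
  "least_common_right_multiple M T m \<longleftrightarrow>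
     common_right_multiple M T m \<and> (\<forall>n. common_right_multiple M T n \<longrightarrow> m divides\<^bsub>M\<^esub> n)"

definition common_left_multiple :: "('a, 'b) monoid_scheme \<Rightarrow> 'a set \<Rightarrow> 'a \<Rightarrow> bool" where
  "common_left_multiple M T m \<longleftrightarrow> m \<in> carrier M \<and> (\<forall>t\<in>T. right_divides M t m)"

definition least_common_left_multiple :: "('a, 'b) monoid_scheme \<Rightarrow> 'a set \<Rightarrow> 'a \<Rightarrow> bool" where
  "least_common_left_multiple M T m \<longleftrightarrow>
     common_left_multiple M T m \<and> (\<forall>n. common_left_multiple M T n \<longrightarrow> right_divides M m n)"

locale pregarside_monoid = monoid_cancel M for M (structure) +
  assumes atomic:
    "\<exists>\<nu> :: 'a \<Rightarrow> nat.
       (\<forall>a\<in>carrier M. a \<noteq> \<one> \<longrightarrow> \<nu> a > 0) \<and>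
       (\<forall>a\<in>carrier M. \<forall>b\<in>carrier M. \<nu> (a \<otimes> b) \<ge> \<nu> a + \<nu> b)"
  and right_lcm_exists:
    "\<lbrakk>a \<in> carrier M; b \<in> carrier M; \<exists>m. common_right_multiple M {a, b} m\<rbrakk>
       \<Longrightarrow> \<exists>m. least_common_right_multiple M {a, b} m"
  and left_lcm_exists:
    "\<lbrakk>a \<in> carrier M; b \<in> carrier M; \<exists>m. common_left_multiple M {a, b} m\<rbrakk>
       \<Longrightarrow> \<exists>m. least_common_left_multiple M {a, b} m"

definition list_product :: "('a, 'b) monoid_scheme \<Rightarrow> 'a list \<Rightarrow> 'a" where
  "list_product M us = foldr (mult M) us \<one>\<^bsub>M\<^esub>"

definition finitely_generated_monoid :: "('a, 'b) monoid_scheme \<Rightarrow> bool" where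
  "finitely_generated_monoid M \<longleftrightarrow>
     (\<exists>G. finite G \<and> G \<subseteq> carrier M \<and>
        (\<forall>u\<in>carrier M. \<exists>us. set us \<subseteq> G \<and> list_product M us = u))"

text \<open>A monoid with such a norm has no units besides \<open>\<one>\<close>, so atoms are defined without reference to units.\<close>

definition atoms :: "('a, 'b) monoid_scheme \<Rightarrow> 'a set" where
  "atoms M = {s \<in> carrier M. s \<noteq> \<one>\<^bsub>M\<^esub> \<and>
     (\<forall>a\<in>carrier M. \<forall>b\<in>carrier M. s = a \<otimes>\<^bsub>M\<^esub> b \<longrightarrow> a = \<one>\<^bsub>M\<^esub> \<or> b = \<one>\<^bsub>M\<^esub>)}"

text \<open>
  The preGarside structure \<open>M\<^sub>r\<^sub>e\<^sub>d\<close> of Bessis, Digne and Michel enters through the properties below.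
  On the carrier, \<open>\<alpha>\<close> is determined by \<open>Mred\<close> via \<open>alpha_in\<close>, \<open>alpha_divides\<close> and
  \<open>alpha_greatest\<close>, since left divisibility is antisymmetric.
\<close>

locale reduced_structure = pregarside_monoid M for M (structure) +
  fixes Mred :: "'a set" and \<alpha> :: "'a \<Rightarrow> 'a"
  assumes Mred_subset: "Mred \<subseteq> carrier M"
  and one_in_Mred: "\<one> \<in> Mred"
  and atoms_in_Mred: "atoms M \<subseteq> Mred"
  and Mred_left_divisor: "\<lbrakk>w \<in> Mred; v \<in> carrier M; v divides w\<rbrakk> \<Longrightarrow> v \<in> Mred"
  and Mred_right_divisor: "\<lbrakk>w \<in> Mred; v \<in> carrier M; right_divides M v w\<rbrakk> \<Longrightarrow> v \<in> Mred"
  and alpha_in: "u \<in> carrier M \<Longrightarrow> \<alpha> u \<in> Mred"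
  and alpha_divides: "u \<in> carrier M \<Longrightarrow> \<alpha> u divides u"
  and alpha_greatest: "\<lbrakk>u \<in> carrier M; v \<in> Mred; v divides u\<rbrakk> \<Longrightarrow> v divides \<alpha> u"
  and alpha_id: "u \<in> Mred \<Longrightarrow> \<alpha> u = u"
  and alpha_mult: "\<lbrakk>u \<in> carrier M; v \<in> carrier M\<rbrakk> \<Longrightarrow> \<alpha> (u \<otimes> v) = \<alpha> (u \<otimes> \<alpha> v)"

definition greedy_normal_form ::
  "('a, 'b) monoid_scheme \<Rightarrow> 'a set \<Rightarrow> ('a \<Rightarrow> 'a) \<Rightarrow> 'a \<Rightarrow> 'a list" where
  "greedy_normal_form M Mred \<alpha> u =
     (if u = \<one>\<^bsub>M\<^esub> then []
      else THE us. set us \<subseteq> Mred - {\<one>\<^bsub>M\<^esub>} \<and> u = list_product M us \<and>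
             (\<forall>i<length us. us ! i = \<alpha> (list_product M (drop i us))))"

definition Delta :: "('a, 'b) monoid_scheme \<Rightarrow> 'a set \<Rightarrow> 'a" where
  "Delta M T = (THE m. least_common_right_multiple M T m)"

definition foata_normal_form :: "('a, 'b) monoid_scheme \<Rightarrow> 'a \<Rightarrow> 'a list" where
  "foata_normal_form M u =
     (if u = \<one>\<^bsub>M\<^esub> then []
      else THE us. set us \<subseteq> carrier M - {\<one>\<^bsub>M\<^esub>} \<and> u = list_product M us \<and>
             (\<forall>i<length us.
                us ! i = Delta M {s \<in> atoms M. s divides\<^bsub>M\<^esub> list_product M (drop i us)}))"

definition agreement :: "('a \<Rightarrow> 'a list) \<Rightarrow> 'a \<Rightarrow> 'a \<Rightarrow> enat" where
  "agreement \<iota> u v =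
     (if u = v then \<infinity>
      else enat (Max {k. k \<le> length (\<iota> u) \<and> k \<le> length (\<iota> v) \<and> take k (\<iota> u) = take k (\<iota> v)}))"

definition normal_form_dist :: "('a \<Rightarrow> 'a list) \<Rightarrow> 'a \<Rightarrow> 'a \<Rightarrow> real" where
  "normal_form_dist \<iota> u v = (case agreement \<iota> u v of enat k \<Rightarrow> 1 / 2 ^ k | \<infinity> \<Rightarrow> 0)"

definition d1 :: "('a, 'b) monoid_scheme \<Rightarrow> 'a set \<Rightarrow> ('a \<Rightarrow> 'a) \<Rightarrow> 'a \<Rightarrow> 'a \<Rightarrow> real" where
  "d1 M Mred \<alpha> = normal_form_dist (greedy_normal_form M Mred \<alpha>)"

definition d2 :: "('a, 'b) monoid_scheme \<Rightarrow> 'a \<Rightarrow> 'a \<Rightarrow> real" where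
  "d2 M = normal_form_dist (foata_normal_form M)"

end

theory Submission
  imports Defs
begin

text \<open>
  Both normal forms arise by splitting off a head again and again: \<open>u = h u \<otimes> c\<close>, then the same for
  \<open>c\<close>. The head \<open>h\<close> is \<open>\<alpha>\<close> for the greedy form and the least common right multiple \<open>\<phi> u\<close> of the
  atoms that divide \<open>u\<close> for the Foata form. The inequality \<open>d\<^sub>2 \<le> d\<^sub>1\<close> says that if the greedy forms
  of \<open>u\<close> and \<open>v\<close> share their first \<open>k\<close> terms, then so do the Foata forms.

  All atoms lie in \<open>M\<^sub>r\<^sub>e\<^sub>d\<close>, so \<open>u\<close> and \<open>\<alpha> u\<close> have the same atoms as divisors. Hence \<open>\<phi> u\<close> depends
  only on \<open>w = \<alpha> u\<close> and divides it, say \<open>w = \<phi> u \<otimes> x\<close>. If \<open>u = w \<otimes> c\<close> and \<open>v = w \<otimes> d\<close>, then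
  splitting off the common Foata head leaves \<open>x \<otimes> c\<close> and \<open>x \<otimes> d\<close>, where the greedy forms of \<open>c\<close> and
  \<open>d\<close> share \<open>k - 1\<close> terms. It remains to see that multiplication on the left by \<open>x\<close> cannot make two
  elements diverge earlier (\<open>common_greedy_terms_mult_left\<close>). This is the law
  \<open>\<alpha> (x \<otimes> c) = \<alpha> (x \<otimes> \<alpha> c)\<close>: the first \<open>j\<close> greedy terms of \<open>x \<otimes> c\<close> are determined by \<open>x\<close>
  and the first \<open>j\<close> greedy terms of \<open>c\<close>. Induction on \<open>k\<close> then finishes the argument
  (\<open>common_foata_terms\<close>).
\<close>

section \<open>Left divisibility in a preGarside monoid\<close>

context pregarside_monoid
begin

text \<open>The norm satisfies \<open>\<nu> \<one> \<ge> \<nu> \<one> + \<nu> \<one>\<close>, so it vanishes at \<open>\<one>\<close>, hence at any factor of \<open>\<one>\<close>.\<close>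

lemma left_factor_of_one:
  assumes "a \<in> carrier M" "b \<in> carrier M" "a \<otimes> b = \<one>"
  shows "a = \<one>"
proof -
  obtain \<nu> :: "'a \<Rightarrow> nat" where pos: "\<forall>a\<in>carrier M. a \<noteq> \<one> \<longrightarrow> \<nu> a > 0"
    and super: "\<forall>a\<in>carrier M. \<forall>b\<in>carrier M. \<nu> (a \<otimes> b) \<ge> \<nu> a + \<nu> b"
    using atomic by blast
  have "\<nu> (\<one> \<otimes> \<one>) \<ge> \<nu> \<one> + \<nu> \<one>" using super by blast
  then have "\<nu> \<one> = 0" by simp
  moreover have "\<nu> \<one> \<ge> \<nu> a + \<nu> b" using super assms by metis
  ultimately have "\<nu> a = 0" by simp
  then show ?thesis using pos assms(1) by force
qed

lemma mult_eq_one_iff: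
  assumes "a \<in> carrier M" "b \<in> carrier M"
  shows "a \<otimes> b = \<one> \<longleftrightarrow> a = \<one> \<and> b = \<one>"
  using assms left_factor_of_one[OF assms] by auto

lemma divides_one_iff: "a \<in> carrier M \<Longrightarrow> a divides \<one> \<longleftrightarrow> a = \<one>"
  by (metis dividesE divides_refl left_factor_of_one)

lemma divides_antisym:
  assumes "a \<in> carrier M" "b \<in> carrier M" "a divides b" "b divides a"
  shows "a = b"
proof -
  obtain c where c: "c \<in> carrier M" "b = a \<otimes> c" using assms(3) by (blast elim: dividesE)
  obtain d where d: "d \<in> carrier M" "a = b \<otimes> d" using assms(4) by (blast elim: dividesE)
  have "a \<otimes> (c \<otimes> d) = a \<otimes> \<one>" using c d assms by (metis m_assoc r_one)
  then have "c \<otimes> d = \<one>" using c(1) d(1) assms(1) by (metis l_cancel m_closed one_closed)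
  then have "c = \<one>" using c(1) d(1) mult_eq_one_iff by blast
  then show ?thesis using c assms by simp
qed

text \<open>
  The norm strictly decreases when a non-trivial factor is removed on either side, so the statement
  may be assumed for what remains.
\<close>

lemma induct_by_factorisation [consumes 1, case_names step]:
  assumes "u \<in> carrier M"
    and step: "\<And>u. u \<in> carrier M \<Longrightarrow>
      (\<And>a b. a \<in> carrier M \<Longrightarrow> b \<in> carrier M \<Longrightarrow> u = a \<otimes> b \<Longrightarrow>
        (a \<noteq> \<one> \<longrightarrow> P b) \<and> (b \<noteq> \<one> \<longrightarrow> P a)) \<Longrightarrow> P u"
  shows "P u"
proof -
  obtain \<nu> :: "'a \<Rightarrow> nat" where pos: "\<forall>a\<in>carrier M. a \<noteq> \<one> \<longrightarrow> \<nu> a > 0"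
    and super: "\<forall>a\<in>carrier M. \<forall>b\<in>carrier M. \<nu> (a \<otimes> b) \<ge> \<nu> a + \<nu> b"
    using atomic by blast
  show ?thesis using assms(1)
  proof (induction "\<nu> u" arbitrary: u rule: less_induct)
    case less
    show ?case
    proof (rule step[OF less.prems])
      fix a b assume ab: "a \<in> carrier M" "b \<in> carrier M" "u = a \<otimes> b"
      then have "\<nu> u \<ge> \<nu> a + \<nu> b" using super by blast
      moreover have "a \<noteq> \<one> \<longrightarrow> \<nu> a > 0" "b \<noteq> \<one> \<longrightarrow> \<nu> b > 0" using pos ab by auto
      ultimately show "(a \<noteq> \<one> \<longrightarrow> P b) \<and> (b \<noteq> \<one> \<longrightarrow> P a)"
        using less.hyps ab by auto
    qed
  qed
qed

lemma atom_divisor_exists: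
  assumes "u \<in> carrier M" "u \<noteq> \<one>"
  shows "\<exists>s\<in>atoms M. s divides u"
  using assms
proof (induction u rule: induct_by_factorisation)
  case (step u)
  show ?case
  proof (cases "u \<in> atoms M")
    case True
    then show ?thesis using step.hyps divides_refl by blast
  next
    case False
    then obtain a b where ab: "a \<in> carrier M" "b \<in> carrier M" "u = a \<otimes> b" "a \<noteq> \<one>" "b \<noteq> \<one>"
      using step unfolding atoms_def by blast
    then obtain s where s: "s \<in> atoms M" "s divides a" using step.IH by blast
    then have "s divides u"
      using ab by (auto simp: atoms_def intro: divides_prod_r)
    then show ?thesis using s by blast
  qed
qed

lemma list_product_Cons [simp]: "list_product M (x # xs) = x \<otimes> list_product M xs"
  by (simp add: list_product_def)

lemma list_product_Nil [simp]: "list_product M [] = \<one>"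
  by (simp add: list_product_def)

lemma list_product_closed: "set xs \<subseteq> carrier M \<Longrightarrow> list_product M xs \<in> carrier M"
  by (induction xs) auto

text \<open>An atom cannot be split, so any word that represents it contains it as a letter.\<close>

lemma atom_is_letter:
  assumes "set xs \<subseteq> carrier M" "list_product M xs \<in> atoms M"
  shows "list_product M xs \<in> set xs"
  using assms
proof (induction xs)
  case Nil
  then show ?case by (simp add: atoms_def)
next
  case (Cons x xs)
  have "x \<in> carrier M" "list_product M xs \<in> carrier M"
    using Cons.prems list_product_closed by auto
  then have "x = \<one> \<or> list_product M xs = \<one>"
    using Cons.prems(2) by (auto simp: atoms_def)
  then show ?case using Cons \<open>x \<in> carrier M\<close> \<open>list_product M xs \<in> carrier M\<close> by auto
qed

lemma finite_atoms:
  assumes "finitely_generated_monoid M"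
  shows "finite (atoms M)"
proof -
  obtain G where G: "finite G" "G \<subseteq> carrier M"
    "\<forall>u\<in>carrier M. \<exists>us. set us \<subseteq> G \<and> list_product M us = u"
    using assms unfolding finitely_generated_monoid_def by blast
  have "atoms M \<subseteq> G"
  proof
    fix s assume s: "s \<in> atoms M"
    then have "s \<in> carrier M" by (simp add: atoms_def)
    then obtain us where "set us \<subseteq> G" "list_product M us = s" using G(3) by blast
    then show "s \<in> G" using atom_is_letter[of us] s G(2) by blast
  qed
  then show ?thesis using G(1) finite_subset by blast
qed

text \<open>
  If \<open>l\<close> is the least common right multiple of \<open>T\<close>, then the common right multiples of
  \<open>insert t T\<close> are those of the pair \<open>{t, l}\<close>, so the axiom on pairs carries the induction.
\<close>

lemma finite_right_lcm_exists:
  assumes "finite T" "T \<subseteq> carrier M" "common_right_multiple M T n"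
  shows "\<exists>m. least_common_right_multiple M T m"
  using assms
proof (induction T rule: finite_induct)
  case empty
  have "least_common_right_multiple M {} \<one>"
    by (auto simp: least_common_right_multiple_def common_right_multiple_def intro: dividesI)
  then show ?case by blast
next
  case (insert t T)
  have n: "n \<in> carrier M" "t divides n" "common_right_multiple M T n"
    using insert.prems by (auto simp: common_right_multiple_def)
  obtain l where l: "least_common_right_multiple M T l" using insert n by auto
  have lc: "l \<in> carrier M" and tc: "t \<in> carrier M"
    using l insert.prems
    by (auto simp: least_common_right_multiple_def common_right_multiple_def)
  have "common_right_multiple M {t, l} n"
    using l n by (auto simp: least_common_right_multiple_def common_right_multiple_def)
  then obtain m where m: "least_common_right_multiple M {t, l} m"
    using right_lcm_exists[OF tc lc] by blast
  have mc: "m \<in> carrier M" "t divides m" "l divides m"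
    using m by (auto simp: least_common_right_multiple_def common_right_multiple_def)
  have "common_right_multiple M (insert t T) m"
    unfolding common_right_multiple_def
  proof (intro conjI ballI)
    fix s assume "s \<in> insert t T"
    then show "s divides m"
    proof
      assume "s \<in> T"
      then have "s divides l" "s \<in> carrier M"
        using l insert.prems(1)
        by (auto simp: least_common_right_multiple_def common_right_multiple_def)
      then show ?thesis using mc divides_trans by blast
    qed (use mc in simp)
  qed (use mc in simp)
  moreover have "m divides p" if "common_right_multiple M (insert t T) p" for p
  proof -
    have "l divides p" "t divides p" "p \<in> carrier M"
      using that l by (auto simp: least_common_right_multiple_def common_right_multiple_def)
    then have "common_right_multiple M {t, l} p" by (simp add: common_right_multiple_def)
    then show ?thesis using m by (simp add: least_common_right_multiple_def)
  qed
  ultimately show ?case by (auto simp: least_common_right_multiple_def)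
qed

lemma Delta_least_common_right_multiple:
  assumes "finite T" "T \<subseteq> carrier M" "common_right_multiple M T n"
  shows "least_common_right_multiple M T (Delta M T)"
proof -
  obtain m where m: "least_common_right_multiple M T m"
    using finite_right_lcm_exists[OF assms] by blast
  have "m' = m" if "least_common_right_multiple M T m'" for m'
    using that m divides_antisym
    by (auto simp: least_common_right_multiple_def common_right_multiple_def)
  then show ?thesis unfolding Delta_def using m by (metis theI)
qed

end

section \<open>Normal forms obtained by splitting off heads\<close>

context pregarside_monoid
begin

text \<open>
  Stating that a list consists of the first terms of a normal form without mentioning the normal
  form itself makes the inductions below independent of its existence.
\<close>

primrec initial_terms :: "('a \<Rightarrow> 'a) \<Rightarrow> 'a list \<Rightarrow> 'a \<Rightarrow> bool" where
  "initial_terms h [] u \<longleftrightarrow> True"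
| "initial_terms h (x # xs) u \<longleftrightarrow>
     x = h u \<and> x \<noteq> \<one> \<and> (\<exists>c\<in>carrier M. u = x \<otimes> c \<and> initial_terms h xs c)"

definition normal_sequence :: "'a set \<Rightarrow> ('a \<Rightarrow> 'a) \<Rightarrow> 'a \<Rightarrow> 'a list \<Rightarrow> bool" where
  "normal_sequence C h u us \<longleftrightarrow> set us \<subseteq> C - {\<one>} \<and> u = list_product M us \<and>
     (\<forall>i<length us. us ! i = h (list_product M (drop i us)))"

definition normal_form :: "'a set \<Rightarrow> ('a \<Rightarrow> 'a) \<Rightarrow> 'a \<Rightarrow> 'a list" where
  "normal_form C h u = (if u = \<one> then [] else THE us. normal_sequence C h u us)"

lemma normal_sequence_Nil [simp]: "normal_sequence C h u [] \<longleftrightarrow> u = \<one>"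
  by (simp add: normal_sequence_def)

lemma normal_sequence_Cons:
  "normal_sequence C h u (x # xs) \<longleftrightarrow>
     x \<in> C - {\<one>} \<and> x = h u \<and> u = x \<otimes> list_product M xs \<and>
     normal_sequence C h (list_product M xs) xs"
  by (auto simp: normal_sequence_def All_less_Suc2)

end

locale head_function = pregarside_monoid M for M (structure) +
  fixes C :: "'a set" and h :: "'a \<Rightarrow> 'a"
  assumes range_subset: "C \<subseteq> carrier M"
    and head_in: "u \<in> carrier M \<Longrightarrow> h u \<in> C"
    and head_divides: "u \<in> carrier M \<Longrightarrow> h u divides u"
    and head_nontrivial: "u \<in> carrier M \<Longrightarrow> u \<noteq> \<one> \<Longrightarrow> h u \<noteq> \<one>"
begin

lemma normal_sequence_exists:
  assumes "u \<in> carrier M"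
  shows "\<exists>us. normal_sequence C h u us"
  using assms
proof (induction u rule: induct_by_factorisation)
  case (step u)
  show ?case
  proof (cases "u = \<one>")
    case True
    then show ?thesis by (metis normal_sequence_Nil)
  next
    case False
    have hc: "h u \<in> carrier M" "h u \<in> C" "h u \<noteq> \<one>"
      using step.hyps False head_in head_nontrivial range_subset by auto
    obtain c where c: "c \<in> carrier M" "u = h u \<otimes> c"
      using head_divides[OF step.hyps] by (blast elim: dividesE)
    then obtain us where us: "normal_sequence C h c us" using step.IH hc by blast
    moreover from us have "c = list_product M us" by (simp add: normal_sequence_def)
    ultimately have "normal_sequence C h u (h u # us)"
      unfolding normal_sequence_Cons using c(2) hc(2,3) by blast
    then show ?thesis by blast
  qed
qed

text \<open>
  Left cancellation determines what remains after each head. When nothing remains, no further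
  term can be split off, because \<open>\<one>\<close> has no non-trivial left factor.
\<close>

lemma initial_terms_iff_prefix:
  assumes "normal_sequence C h u us"
  shows "initial_terms h ws u \<longleftrightarrow> length ws \<le> length us \<and> take (length ws) us = ws"
  using assms
proof (induction us arbitrary: ws u)
  case Nil
  have "h \<one> \<in> carrier M" using head_in[OF one_closed] range_subset by blast
  have no_head: "\<not> initial_terms h (x # xs) \<one>" for x xs
  proof
    assume "initial_terms h (x # xs) \<one>"
    then obtain c where "h \<one> \<noteq> \<one>" "c \<in> carrier M" "h \<one> \<otimes> c = \<one>" by auto
    then show False using left_factor_of_one \<open>h \<one> \<in> carrier M\<close> by blast
  qed
  have "u = \<one>" using Nil by simp
  then show ?case using no_head by (cases ws) simp_all
next
  case (Cons y us)
  have y: "y \<in> carrier M" "y \<noteq> \<one>" "y = h u" and u: "u = y \<otimes> list_product M us"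
    and us: "normal_sequence C h (list_product M us) us"
    using Cons.prems range_subset unfolding normal_sequence_Cons by blast+
  have pc: "list_product M us \<in> carrier M"
    using us range_subset by (auto simp: normal_sequence_def intro!: list_product_closed)
  show ?case
  proof (cases ws)
    case (Cons x xs)
    have "initial_terms h ws u \<longleftrightarrow> x = y \<and> initial_terms h xs (list_product M us)"
    proof
      assume "initial_terms h ws u"
      then obtain c where c: "x = y" "c \<in> carrier M" "u = y \<otimes> c" "initial_terms h xs c"
        unfolding \<open>ws = x # xs\<close> initial_terms.simps using y(3) by blast
      then have "c = list_product M us" using u y pc by (metis l_cancel)
      then show "x = y \<and> initial_terms h xs (list_product M us)" using c by simp
    next
      assume "x = y \<and> initial_terms h xs (list_product M us)"
      then show "initial_terms h ws u"
        unfolding \<open>ws = x # xs\<close> initial_terms.simps using y(2,3) u pc by blast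
    qed
    then show ?thesis using Cons.IH[OF us, of xs] \<open>ws = x # xs\<close> by auto
  qed simp
qed

lemma normal_sequence_unique:
  assumes "normal_sequence C h u us" "normal_sequence C h u vs"
  shows "us = vs"
proof -
  note us = initial_terms_iff_prefix[OF assms(1)] and vs = initial_terms_iff_prefix[OF assms(2)]
  have "initial_terms h us u" unfolding us by simp
  then have "length us \<le> length vs \<and> take (length us) vs = us" unfolding vs .
  moreover have "initial_terms h vs u" unfolding vs by simp
  then have "length vs \<le> length us \<and> take (length vs) us = vs" unfolding us .
  ultimately show ?thesis by (metis take_all)
qed

lemma normal_sequence_normal_form:
  assumes "u \<in> carrier M"
  shows "normal_sequence C h u (normal_form C h u)"
proof (cases "u = \<one>")
  case False
  have "\<exists>!us. normal_sequence C h u us"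
    using normal_sequence_exists[OF assms] normal_sequence_unique by blast
  then have "normal_sequence C h u (THE us. normal_sequence C h u us)" by (rule theI')
  then show ?thesis using False by (simp add: normal_form_def)
qed (simp add: normal_form_def)

lemma normal_forms_agree_iff:
  assumes "u \<in> carrier M" "v \<in> carrier M"
  shows "k \<le> length (normal_form C h u) \<and> k \<le> length (normal_form C h v) \<and>
      take k (normal_form C h u) = take k (normal_form C h v) \<longleftrightarrow>
    (\<exists>ws. length ws = k \<and> initial_terms h ws u \<and> initial_terms h ws v)" (is "?L \<longleftrightarrow> ?R")
proof -
  note iff = initial_terms_iff_prefix[OF normal_sequence_normal_form[OF assms(1)]]
    initial_terms_iff_prefix[OF normal_sequence_normal_form[OF assms(2)]]
  show ?thesis
  proof
    assume ?L
    then have "length (take k (normal_form C h u)) = k \<and>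
        initial_terms h (take k (normal_form C h u)) u \<and>
        initial_terms h (take k (normal_form C h u)) v"
      unfolding iff by simp
    then show ?R by blast
  next
    assume ?R
    then show ?L unfolding iff by metis
  qed
qed

end

lemma normal_form_dist_mono:
  assumes "\<And>k. k \<le> length (\<iota> u) \<and> k \<le> length (\<iota> v) \<and> take k (\<iota> u) = take k (\<iota> v) \<Longrightarrow>
    k \<le> length (\<kappa> u) \<and> k \<le> length (\<kappa> v) \<and> take k (\<kappa> u) = take k (\<kappa> v)"
  shows "normal_form_dist \<kappa> u v \<le> normal_form_dist \<iota> u v"
proof (cases "u = v")
  case False
  let ?A = "\<lambda>f. {k. k \<le> length (f u) \<and> k \<le> length (f v) \<and> take k (f u) = take k (f v)}"
  have fin: "finite (?A \<kappa>)" by (rule finite_subset[of _ "{..length (\<kappa> u)}"]) auto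
  have "0 \<in> ?A \<iota>" by simp
  then have "Max (?A \<iota>) \<le> Max (?A \<kappa>)"
    using assms by (intro Max_mono fin) blast+
  then have "(2::real) ^ Max (?A \<iota>) \<le> 2 ^ Max (?A \<kappa>)" by (intro power_increasing) auto
  then show ?thesis using False
    by (simp add: normal_form_dist_def agreement_def frac_le)
qed (simp add: normal_form_dist_def agreement_def)

section \<open>Greedy terms determine Foata terms\<close>

context pregarside_monoid
begin

definition foata_head :: "'a \<Rightarrow> 'a" where
  "foata_head u = Delta M {s \<in> atoms M. s divides u}"

lemma foata_head_lcm:
  assumes "finite (atoms M)" "u \<in> carrier M"
  shows "least_common_right_multiple M {s \<in> atoms M. s divides u} (foata_head u)"
  unfolding foata_head_def
proof (rule Delta_least_common_right_multiple)
  show "finite {s \<in> atoms M. s divides u}" using assms(1) by simp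
  show "{s \<in> atoms M. s divides u} \<subseteq> carrier M" by (auto simp: atoms_def)
  show "common_right_multiple M {s \<in> atoms M. s divides u} u"
    using assms(2) by (simp add: common_right_multiple_def)
qed

lemma foata_head_function:
  assumes "finite (atoms M)"
  shows "head_function M (carrier M) foata_head"
proof unfold_locales
  fix u assume u: "u \<in> carrier M"
  note lcm = foata_head_lcm[OF assms u]
  show "foata_head u \<in> carrier M"
    using lcm by (simp add: least_common_right_multiple_def common_right_multiple_def)
  show "foata_head u divides u"
    using lcm u by (simp add: least_common_right_multiple_def common_right_multiple_def)
  assume "u \<noteq> \<one>"
  then obtain s where s: "s \<in> atoms M" "s divides u" using atom_divisor_exists u by blast
  then have "s divides foata_head u"
    using lcm by (simp add: least_common_right_multiple_def common_right_multiple_def)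
  then show "foata_head u \<noteq> \<one>"
    using s(1) divides_one_iff by (auto simp: atoms_def)
qed simp

end

context reduced_structure
begin

lemma alpha_closed: "u \<in> carrier M \<Longrightarrow> \<alpha> u \<in> carrier M"
  using alpha_in Mred_subset by blast

lemma atom_divides_alpha_iff:
  assumes "s \<in> atoms M" "u \<in> carrier M"
  shows "s divides \<alpha> u \<longleftrightarrow> s divides u"
  using assms alpha_greatest atoms_in_Mred alpha_divides alpha_closed divides_trans
  by (metis (no_types, lifting) atoms_def mem_Collect_eq subsetD)

lemma foata_head_alpha: "u \<in> carrier M \<Longrightarrow> foata_head (\<alpha> u) = foata_head u"
  unfolding foata_head_def by (metis (no_types, lifting) Collect_cong atom_divides_alpha_iff)

lemma alpha_nontrivial:
  assumes "u \<in> carrier M" "u \<noteq> \<one>"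
  shows "\<alpha> u \<noteq> \<one>"
proof -
  obtain s where s: "s \<in> atoms M" "s divides u" using atom_divisor_exists assms by blast
  then have "s divides \<alpha> u" using atom_divides_alpha_iff assms by blast
  then show ?thesis using s(1) divides_one_iff by (auto simp: atoms_def)
qed

lemma alpha_head_function: "head_function M Mred \<alpha>"
  by unfold_locales (auto simp: Mred_subset alpha_in alpha_divides alpha_nontrivial)

text \<open>
  Let \<open>w\<close> be the first greedy term of both \<open>c = w \<otimes> c'\<close> and \<open>d = w \<otimes> d'\<close>. The multiplication law
  gives \<open>x \<otimes> c\<close> and \<open>x \<otimes> d\<close> the common head \<open>y = \<alpha> (x \<otimes> w)\<close>. Writing \<open>x \<otimes> w = y \<otimes> x'\<close> leaves
  \<open>x' \<otimes> c'\<close> and \<open>x' \<otimes> d'\<close>: the multiplier has moved past one term. The new terms never become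
  trivial before the old ones run out, as \<open>x \<otimes> w = \<one>\<close> would force \<open>w = \<one>\<close>.
\<close>

lemma common_greedy_terms_mult_left:
  assumes "x \<in> carrier M" "c \<in> carrier M" "d \<in> carrier M"
    and "initial_terms \<alpha> ws c" "initial_terms \<alpha> ws d"
  shows "\<exists>ys. length ys = length ws \<and> initial_terms \<alpha> ys (x \<otimes> c) \<and> initial_terms \<alpha> ys (x \<otimes> d)"
  using assms
proof (induction ws arbitrary: x c d)
  case (Cons w ws)
  obtain c' where c': "c' \<in> carrier M" "c = w \<otimes> c'" "initial_terms \<alpha> ws c'"
    and w: "w = \<alpha> c" "w \<noteq> \<one>"
    using Cons.prems(4) unfolding initial_terms.simps by blast
  obtain d' where d': "d' \<in> carrier M" "d = w \<otimes> d'" "initial_terms \<alpha> ws d'" "w = \<alpha> d"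
    using Cons.prems(5) unfolding initial_terms.simps by blast
  have wc: "w \<in> carrier M" using w Cons.prems alpha_closed by blast
  define y where "y = \<alpha> (x \<otimes> w)"
  have yc: "y \<in> carrier M" unfolding y_def using wc Cons.prems(1) alpha_closed by simp
  have "x \<otimes> w \<noteq> \<one>" using w(2) wc Cons.prems mult_eq_one_iff by blast
  then have "y \<noteq> \<one>" unfolding y_def using alpha_nontrivial wc Cons.prems(1) by simp
  have heads: "\<alpha> (x \<otimes> c) = y" "\<alpha> (x \<otimes> d) = y"
    using alpha_mult[OF Cons.prems(1,2)] alpha_mult[OF Cons.prems(1,3)]
    unfolding y_def w(1)[symmetric] d'(4)[symmetric] .
  obtain x' where x': "x' \<in> carrier M" "x \<otimes> w = y \<otimes> x'"
    using alpha_divides[of "x \<otimes> w"] wc Cons.prems(1) unfolding y_def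
    by (blast elim: dividesE)
  have split: "x \<otimes> c = y \<otimes> (x' \<otimes> c')" "x \<otimes> d = y \<otimes> (x' \<otimes> d')"
    using c'(1,2) d'(1,2) x' wc yc Cons.prems(1) by (metis m_assoc)+
  obtain ys where ys: "length ys = length ws" "initial_terms \<alpha> ys (x' \<otimes> c')"
    "initial_terms \<alpha> ys (x' \<otimes> d')"
    using Cons.IH[OF x'(1) c'(1) d'(1) c'(3) d'(3)] by blast
  have closed: "x' \<otimes> c' \<in> carrier M" "x' \<otimes> d' \<in> carrier M" using x'(1) c'(1) d'(1) by simp_all
  have "initial_terms \<alpha> (y # ys) (x \<otimes> c)" "initial_terms \<alpha> (y # ys) (x \<otimes> d)"
    unfolding initial_terms.simps
    using heads[symmetric] \<open>y \<noteq> \<one>\<close> closed split ys(2,3)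
    by metis+
  then show ?case using ys(1) by (metis length_Cons)
qed simp

text \<open>
  The induction is on the number of greedy terms, not on their list: after the first Foata term is
  split off, the multiplier \<open>x\<close> left over from \<open>w\<close> changes all later greedy terms and preserves
  only how many of them are shared.
\<close>

lemma common_foata_terms:
  assumes fin: "finite (atoms M)"
    and "u \<in> carrier M" "v \<in> carrier M"
    and "initial_terms \<alpha> ws u" "initial_terms \<alpha> ws v"
  shows "\<exists>zs. length zs = length ws \<and> initial_terms foata_head zs u \<and> initial_terms foata_head zs v"
  using assms(2-)
proof (induction "length ws" arbitrary: ws u v)
  case (Suc k)
  then obtain w ws' where ws: "ws = w # ws'" by (metis length_Suc_conv)
  obtain c where c: "c \<in> carrier M" "u = w \<otimes> c" "initial_terms \<alpha> ws' c"
    and w: "w = \<alpha> u" "w \<noteq> \<one>"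
    using Suc.prems(3) unfolding ws initial_terms.simps by blast
  obtain d where d: "d \<in> carrier M" "v = w \<otimes> d" "initial_terms \<alpha> ws' d" "w = \<alpha> v"
    using Suc.prems(4) unfolding ws initial_terms.simps by blast
  interpret F: head_function M "carrier M" foata_head by (rule foata_head_function[OF fin])
  have wc: "w \<in> carrier M" using w Suc.prems alpha_closed by blast
  define z where "z = foata_head w"
  have heads: "foata_head u = z" "foata_head v = z"
    unfolding z_def
    using w(1) d(4) foata_head_alpha[OF Suc.prems(1)] foata_head_alpha[OF Suc.prems(2)] by metis+
  have zc: "z \<in> carrier M" "z \<noteq> \<one>"
    unfolding z_def using F.head_in F.head_nontrivial wc w(2) by blast+
  obtain x where x: "x \<in> carrier M" "w = z \<otimes> x"
    using F.head_divides[OF wc] unfolding z_def by (blast elim: dividesE)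
  have split: "u = z \<otimes> (x \<otimes> c)" "v = z \<otimes> (x \<otimes> d)"
    using c(1,2) d(1,2) x zc by (metis m_assoc)+
  have closed: "x \<otimes> c \<in> carrier M" "x \<otimes> d \<in> carrier M" using x(1) c(1) d(1) by simp_all
  obtain ys where ys: "length ys = length ws'" "initial_terms \<alpha> ys (x \<otimes> c)"
    "initial_terms \<alpha> ys (x \<otimes> d)"
    using common_greedy_terms_mult_left[OF x(1) c(1) d(1) c(3) d(3)] by blast
  have "k = length ys" using Suc.hyps(2) ws ys(1) by simp
  then obtain zs where zs: "length zs = length ys" "initial_terms foata_head zs (x \<otimes> c)"
    "initial_terms foata_head zs (x \<otimes> d)"
    using Suc.hyps(1) closed ys(2,3) by blast
  have "initial_terms foata_head (z # zs) u" "initial_terms foata_head (z # zs) v"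
    unfolding initial_terms.simps
    using heads[symmetric] zc(2) closed split zs(2,3)
    by metis+
  moreover have "length (z # zs) = length ws" using zs(1) ys(1) ws by simp
  ultimately show ?case by blast
qed simp

end

theorem proposition3p4:
  fixes M :: "('a, 'b) monoid_scheme" and Mred :: "'a set" and \<alpha> :: "'a \<Rightarrow> 'a"
  assumes "pregarside_monoid M"
    and "finitely_generated_monoid M"
    and "reduced_structure M Mred \<alpha>"
  shows "\<forall>u\<in>carrier M. \<forall>v\<in>carrier M. d2 M u v \<le> d1 M Mred \<alpha> u v"
proof (intro ballI)
  fix u v assume uv: "u \<in> carrier M" "v \<in> carrier M"
  interpret reduced_structure M Mred \<alpha> by (rule assms(3))
  have fin: "finite (atoms M)" by (rule finite_atoms[OF assms(2)])
  interpret G: head_function M Mred \<alpha> by (rule alpha_head_function)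
  interpret F: head_function M "carrier M" foata_head by (rule foata_head_function[OF fin])
  have greedy: "greedy_normal_form M Mred \<alpha> = normal_form Mred \<alpha>"
    by (rule ext) (simp add: greedy_normal_form_def normal_form_def normal_sequence_def)
  have foata: "foata_normal_form M = normal_form (carrier M) foata_head"
    by (rule ext)
      (simp add: foata_normal_form_def normal_form_def normal_sequence_def foata_head_def)
  show "d2 M u v \<le> d1 M Mred \<alpha> u v"
    unfolding d1_def d2_def greedy foata
  proof (rule normal_form_dist_mono)
    fix k
    assume "k \<le> length (normal_form Mred \<alpha> u) \<and> k \<le> length (normal_form Mred \<alpha> v) \<and>
      take k (normal_form Mred \<alpha> u) = take k (normal_form Mred \<alpha> v)"
    then obtain ws where ws: "length ws = k" "initial_terms \<alpha> ws u" "initial_terms \<alpha> ws v"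
      using G.normal_forms_agree_iff[OF uv] by blast
    then show "k \<le> length (normal_form (carrier M) foata_head u) \<and>
      k \<le> length (normal_form (carrier M) foata_head v) \<and>
      take k (normal_form (carrier M) foata_head u) = take k (normal_form (carrier M) foata_head v)"
      using F.normal_forms_agree_iff[OF uv] common_foata_terms[OF fin uv ws(2,3)] by blast
  qed
qed

end
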